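(* Let $m\ge 1$, let $I$ be a finite nonempty set, and for each $i\in I$ let $q_i>0$, let $G^i$ be a GEV choice probability generating function on $\mathbb{R}^m_+$, and let $\mathcal{V}_i\subset\mathbb{R}^m$ be an uncertainty set. Define, for $S\subset[m]$, $$f^{\mathrm{WC}}(S)=\sum_{i\in I}q_i-\sum_{i\in I}\frac{q_i}{1+\min_{\mathbf{v}^i\in\mathcal{V}_i}\{G^i(\mathbf{Y}(\mathbf{v}^i)\,|\,S)\}}.$$ Then for every $S\subset[m]$ and every $j\in[m]\setminus S$, $$f^{\mathrm{WC}}(S\cup\{j\})>f^{\mathrm{WC}}(S).$$
   Context: $[m]=\{1,\dots,m\}$. GEV choice probability generating function (CPGF): a continuous function $G:\mathbb{R}^m_+\to\mathbb{R}$ with continuous mixed partial derivatives at points with strictly positive entries, such that (i) $G(\mathbf{Y})\ge 0$ for all $\mathbf{Y}\in\mathbb{R}^m_+$; (ii) $G(\lambda\mathbf{Y})=\lambda G(\mathbf{Y})$ for every scalar $\lambda>0$; (iii) $G(\mathbf{Y})\to\infty$ if $Y_j\to\infty$, for any $j\in[m]$; (iv) for distinct $j_1,\dots,j_k\in[m]$, the mixed partial derivative $\partial G_{j_1\dots j_k}(\mathbf{Y})$ with respect to $Y_{j_1},\dots,Y_{j_k}$ is $>0$ if $k$ is odd and $\le 0$ if $k$ is even. For $\mathbf{v}\in\mathbb{R}^m$, $\mathbf{Y}(\mathbf{v})\in\mathbb{R}^m$ has entries $Y(\mathbf{v})_j=e^{v_j}$. For $S\subset[m]$, $G(\mathbf{Y}|S)=G(\overline{\mathbf{Y}})$,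 where $\overline{Y}_j=Y_j$ if $j\in S$ and $\overline{Y}_j=0$ otherwise. As a function of the variables $(Y_j)_{j\in S}$, $G(\cdot|S)$ is understood to satisfy the same properties. Uncertainty sets: each $\mathcal{V}_i\subset\mathbb{R}^m$ is nonempty, convex and bounded, of the form $\{\mathbf{v}\in\mathbb{R}^m: g^i_t(\mathbf{v})\le 0,\ t=1,\dots,T\}$ with convex functions $g^i_t:\mathbb{R}^m\to\mathbb{R}$; the sets are independent across $i\in I$. Here $i\in I$ are customer zones, $q_i$ is the number of customers in zone $i$, and $[m]$ is the set of available locations. *)

theory Defs
  imports "HOL-Analysis.Analysis"
begin

definition nonneg_orthant :: "(real ^ 'm) set" where
  "nonneg_orthant = {Y. \<forall>j. 0 \<le> Y $ j}"

definition pos_orthant :: "(real ^ 'm) set" where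
  "pos_orthant = {Y. \<forall>j. 0 < Y $ j}"

definition set_coord :: "real ^ 'm \<Rightarrow> 'm \<Rightarrow> real \<Rightarrow> real ^ 'm" where
  "set_coord Y j t = (\<chi> k. if k = j then t else Y $ k)"

definition restrict_to :: "'m set \<Rightarrow> real ^ 'm \<Rightarrow> real ^ 'm" where
  "restrict_to S Y = (\<chi> j. if j \<in> S then Y $ j else 0)"

definition exp_vec :: "real ^ 'm \<Rightarrow> real ^ 'm" where
  "exp_vec v = (\<chi> j. exp (v $ j))"

text \<open>The head of the list is the variable differentiated last. Existence of the derivatives is
  not part of this definition; it is required separately in \<open>cpgf_on\<close>.\<close>

primrec mixed_partial :: "'m list \<Rightarrow> (real ^ 'm \<Rightarrow> real) \<Rightarrow> real ^ 'm \<Rightarrow> real" where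
  "mixed_partial [] F = F"
| "mixed_partial (j # js) F = (\<lambda>Y. deriv (\<lambda>t. mixed_partial js F (set_coord Y j t)) (Y $ j))"

text \<open>The properties of a GEV choice probability generating function for a function \<open>F\<close> of the
  variables \<open>Y\<^sub>j\<close> with \<open>j \<in> S\<close>. Such an \<open>F\<close> is represented as a function on all of the
  orthant that ignores the coordinates outside \<open>S\<close>, so that quantifying over all points
  \<open>Y\<close> of the (positive) orthant amounts to quantifying over all (positive) \<open>(Y\<^sub>j)\<close> with
  \<open>j \<in> S\<close>. Values of \<open>F\<close> outside the nonnegative orthant are irrelevant. Mixed partial
  derivatives are those with respect to pairwise distinct variables, in any order.\<close>

definition cpgf_on :: "'m set \<Rightarrow> (real ^ 'm \<Rightarrow> real) \<Rightarrow> bool" where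
  "cpgf_on S F \<longleftrightarrow>
     continuous_on nonneg_orthant F \<and>
     (\<forall>j js. distinct (j # js) \<and> set (j # js) \<subseteq> S \<longrightarrow>
        (\<forall>Y\<in>pos_orthant. (\<lambda>t. mixed_partial js F (set_coord Y j t)) differentiable (at (Y $ j))) \<and>
        continuous_on pos_orthant (mixed_partial (j # js) F)) \<and>
     (\<forall>Y\<in>nonneg_orthant. F Y \<ge> 0) \<and>
     (\<forall>Y\<in>nonneg_orthant. \<forall>c>0. F (c *\<^sub>R Y) = c * F Y) \<and>
     (\<forall>j\<in>S. \<forall>Y\<in>nonneg_orthant. filterlim (\<lambda>t. F (set_coord Y j t)) at_top at_top) \<and>
     (\<forall>js. js \<noteq> [] \<and> distinct js \<and> set js \<subseteq> S \<longrightarrow>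
        (\<forall>Y\<in>pos_orthant.
           (odd (length js) \<longrightarrow> mixed_partial js F Y > 0) \<and>
           (even (length js) \<longrightarrow> mixed_partial js F Y \<le> 0)))"

definition gev_cpgf :: "(real ^ 'm \<Rightarrow> real) \<Rightarrow> bool" where
  "gev_cpgf G \<longleftrightarrow> cpgf_on UNIV G \<and> (\<forall>S. cpgf_on S (\<lambda>Y. G (restrict_to S Y)))"

definition uncertainty_set :: "nat \<Rightarrow> (real ^ 'm) set \<Rightarrow> bool" where
  "uncertainty_set T V \<longleftrightarrow>
     V \<noteq> {} \<and> convex V \<and> bounded V \<and>
     (\<exists>g :: nat \<Rightarrow> real ^ 'm \<Rightarrow> real.
        (\<forall>t\<in>{1..T}. convex_on UNIV (g t)) \<and> V = {v. \<forall>t\<in>{1..T}. g t v \<le> 0})"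

text \<open>\<open>LEAST\<close> picks the least element of the set of attained values, i.e. the minimum over
  \<open>V i\<close> (\<open>Min\<close> is only meaningful for finite sets).\<close>

definition f_WC ::
  "'i set \<Rightarrow> ('i \<Rightarrow> real) \<Rightarrow> ('i \<Rightarrow> real ^ 'm \<Rightarrow> real) \<Rightarrow> ('i \<Rightarrow> (real ^ 'm) set) \<Rightarrow> 'm set \<Rightarrow> real"
where
  "f_WC I q G V S =
     (\<Sum>i\<in>I. q i) -
     (\<Sum>i\<in>I. q i / (1 + (LEAST x. x \<in> (\<lambda>v. G i (restrict_to S (exp_vec v))) ` V i)))"

end

theory Submission
  imports Defs
begin

text \<open>Adding a location strictly increases every generating function at a positive vector \<open>Y\<close>: with all other
  entries held fixed, \<open>G(Y | S \<union> {j})\<close> as a function of \<open>Y\<^sub>j\<close> takes the value \<open>G(Y | S)\<close> at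
  \<open>Y\<^sub>j = 0\<close>, is continuous there, and has a positive derivative for \<open>Y\<^sub>j > 0\<close>, so the mean value
  theorem applies on \<open>[0, Y\<^sub>j]\<close> (\<open>cpgf_on_coord_zero_less\<close>).

  A pointwise strict inequality need not survive taking infima, but it survives taking minima:
  at a minimiser \<open>v\<close> for \<open>S \<union> {j}\<close>, the minimum for \<open>S\<close> is at most the value at \<open>v\<close> for \<open>S\<close>,
  which is strictly below the minimum for \<open>S \<union> {j}\<close> (\<open>least_image_strict_mono\<close>). Minimisers exist
  because an uncertainty set is compact: finite convex functions on a Euclidean space are
  continuous, so their sublevel sets are closed (\<open>uncertainty_set_compact\<close>).

  The worst-case minima are nonnegative, and for \<open>q > 0\<close> the map \<open>x \<mapsto> q / (1 + x)\<close> decreases strictly on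
  nonnegative \<open>x\<close>, so the term of every zone strictly decreases.\<close>

lemma uncertainty_set_compact:
  assumes "uncertainty_set T V"
  shows "compact V"
proof -
  obtain g :: "nat \<Rightarrow> real ^ 'a \<Rightarrow> real" where
    g: "\<forall>t\<in>{1..T}. convex_on UNIV (g t)" "V = {v. \<forall>t\<in>{1..T}. g t v \<le> 0}"
    and "bounded V"
    using assms unfolding uncertainty_set_def by blast
  have "closed {v. g t v \<le> 0}" if "t \<in> {1..T}" for t
  proof (rule closed_Collect_le)
    show "continuous_on UNIV (g t)"
      using g(1) that by (intro convex_on_continuous) auto
  qed simp
  moreover have "V = (\<Inter>t\<in>{1..T}. {v. g t v \<le> 0})"
    using g(2) by auto
  ultimately have "closed V"
    by auto
  with \<open>bounded V\<close> show ?thesis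
    by (simp add: compact_eq_bounded_closed)
qed

lemma continuous_on_cpgf_exp_vec:
  fixes G :: "real ^ 'm \<Rightarrow> real"
  assumes "continuous_on nonneg_orthant G"
  shows "continuous_on A (\<lambda>v. G (restrict_to S (exp_vec v)))"
proof (rule continuous_on_compose2[OF assms])
  have "continuous_on A (\<lambda>v :: real ^ 'm. if k \<in> S then exp (v $ k) else 0)" for k
    by (cases "k \<in> S") (auto intro!: continuous_intros)
  then show "continuous_on A (\<lambda>v :: real ^ 'm. restrict_to S (exp_vec v))"
    unfolding restrict_to_def exp_vec_def vec_lambda_beta by (rule continuous_on_vec_lambda)
qed (auto simp: restrict_to_def exp_vec_def nonneg_orthant_def)

text \<open>The sign condition on first partial derivatives is imposed only on the open orthant; continuity
  on the closed orthant is what carries the strict monotonicity down to the boundary point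
  \<open>Y\<^sub>j = 0\<close>.\<close>

lemma cpgf_on_coord_zero_less:
  fixes F :: "real ^ 'm \<Rightarrow> real"
  assumes F: "cpgf_on S F" and "j \<in> S" and Y: "Y \<in> pos_orthant"
  shows "F (set_coord Y j 0) < F Y"
proof -
  define h where "h = (\<lambda>t. F (set_coord Y j t))"
  have pos: "0 < Y $ j"
    using Y by (simp add: pos_orthant_def)
  have cont: "continuous_on {0..Y $ j} h"
    unfolding h_def
  proof (rule continuous_on_compose2[where g = F and f = "set_coord Y j"])
    show "continuous_on nonneg_orthant F"
      using F by (simp add: cpgf_on_def)
    have "continuous_on {0..Y $ j} (\<lambda>t. if k = j then t else Y $ k)" for k
      by (cases "k = j") (auto intro!: continuous_intros)
    then show "continuous_on {0..Y $ j} (set_coord Y j)"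
      unfolding set_coord_def by (auto intro!: continuous_intros)
    show "set_coord Y j ` {0..Y $ j} \<subseteq> nonneg_orthant"
      using Y by (auto simp: set_coord_def nonneg_orthant_def pos_orthant_def less_imp_le)
  qed
  have "\<exists>d. (h has_real_derivative d) (at t) \<and> 0 < d" if "0 < t" for t
  proof -
    let ?Z = "set_coord Y j t"
    have Z: "?Z \<in> pos_orthant" "?Z $ j = t"
      using Y that by (auto simp: pos_orthant_def set_coord_def)
    have upd: "set_coord ?Z j s = set_coord Y j s" for s
      by (simp add: set_coord_def vec_eq_iff)
    have "(\<lambda>s. mixed_partial [] F (set_coord ?Z j s)) differentiable (at (?Z $ j))"
      using F[unfolded cpgf_on_def, THEN conjunct2, THEN conjunct1, rule_format, of j "[]"]
        \<open>j \<in> S\<close> Z(1) by simp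
    then have "h differentiable (at t)"
      by (simp add: Z(2) upd h_def)
    moreover have "0 < mixed_partial [j] F ?Z"
    proof -
      have "\<forall>js. js \<noteq> [] \<and> distinct js \<and> set js \<subseteq> S \<longrightarrow>
          (\<forall>Y\<in>pos_orthant. (odd (length js) \<longrightarrow> mixed_partial js F Y > 0) \<and>
            (even (length js) \<longrightarrow> mixed_partial js F Y \<le> 0))"
        using F unfolding cpgf_on_def by (elim conjE)
      from spec[OF this, of "[j]"] show ?thesis
        using \<open>j \<in> S\<close> Z(1) by simp
    qed
    then have "0 < deriv h t"
      using Z(2) upd by (simp add: h_def)
    ultimately show ?thesis
      using DERIV_deriv_iff_real_differentiable by blast
  qed
  then have "h 0 < h (Y $ j)"
    using DERIV_pos_imp_increasing_open[OF pos _ cont] by blast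
  moreover have "set_coord Y j (Y $ j) = Y"
    by (simp add: set_coord_def vec_eq_iff)
  ultimately show ?thesis
    by (simp add: h_def)
qed

lemma gev_cpgf_insert_less:
  fixes G :: "real ^ 'm \<Rightarrow> real"
  assumes G: "gev_cpgf G" and "j \<notin> S" and Y: "Y \<in> pos_orthant"
  shows "G (restrict_to S Y) < G (restrict_to (S \<union> {j}) Y)"
proof -
  have "cpgf_on (S \<union> {j}) (\<lambda>Y. G (restrict_to (S \<union> {j}) Y))"
    using G by (simp add: gev_cpgf_def)
  from cpgf_on_coord_zero_less[OF this _ Y, of j]
  have "G (restrict_to (S \<union> {j}) (set_coord Y j 0)) < G (restrict_to (S \<union> {j}) Y)"
    by simp
  moreover have "restrict_to (S \<union> {j}) (set_coord Y j 0) = restrict_to S Y"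
    using \<open>j \<notin> S\<close> by (auto simp: restrict_to_def set_coord_def vec_eq_iff)
  ultimately show ?thesis
    by simp
qed

text \<open>Attainment of the minimum is what gives meaning to the least element of the image, whose
  value is otherwise unspecified.\<close>

lemma least_image_attained:
  fixes f :: "'a :: topological_space \<Rightarrow> real"
  assumes "compact K" "K \<noteq> {}" "continuous_on K f"
  obtains v where "v \<in> K" "(LEAST x. x \<in> f ` K) = f v" "\<And>w. w \<in> K \<Longrightarrow> f v \<le> f w"
proof -
  obtain v where v: "v \<in> K" "\<forall>w\<in>K. f v \<le> f w"
    using continuous_attains_inf[OF assms] by blast
  then have "(LEAST x. x \<in> f ` K) = f v"
    by (intro Least_equality) auto
  with v that show ?thesis
    by blast
qed

lemma least_image_strict_mono:
  fixes f g :: "'a :: topological_space \<Rightarrow> real"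
  assumes "compact K" "K \<noteq> {}" "continuous_on K f" "continuous_on K g"
    and less: "\<And>v. v \<in> K \<Longrightarrow> f v < g v"
  shows "(LEAST x. x \<in> f ` K) < (LEAST x. x \<in> g ` K)"
proof -
  obtain u where u: "(LEAST x. x \<in> f ` K) = f u" "\<And>w. w \<in> K \<Longrightarrow> f u \<le> f w"
    using least_image_attained[OF assms(1-3)] by blast
  obtain v where v: "v \<in> K" "(LEAST x. x \<in> g ` K) = g v"
    using least_image_attained[OF assms(1,2,4)] by blast
  have "f u \<le> f v"
    using u(2) v(1) .
  also have "f v < g v"
    using less v(1) .
  finally show ?thesis
    by (simp add: u(1) v(2))
qed

theorem theorem1:
  fixes I :: "'i set"
    and q :: "'i \<Rightarrow> real"
    and G :: "'i \<Rightarrow> real ^ 'm \<Rightarrow> real"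
    and V :: "'i \<Rightarrow> (real ^ 'm) set"
    and T :: nat
    and S :: "'m set"
    and j :: 'm
  assumes "finite I" and "I \<noteq> {}"
    and "\<And>i. i \<in> I \<Longrightarrow> q i > 0"
    and "\<And>i. i \<in> I \<Longrightarrow> gev_cpgf (G i)"
    and "\<And>i. i \<in> I \<Longrightarrow> uncertainty_set T (V i)"
    and "j \<notin> S"
  shows "f_WC I q G V (S \<union> {j}) > f_WC I q G V S"
proof -
  define W where "W = (\<lambda>i R. LEAST x. x \<in> (\<lambda>v. G i (restrict_to R (exp_vec v))) ` V i)"
  have "q i / (1 + W i (S \<union> {j})) < q i / (1 + W i S)" if i: "i \<in> I" for i
  proof -
    have V: "compact (V i)" "V i \<noteq> {}"
      using assms(5)[OF i] uncertainty_set_compact by (auto simp: uncertainty_set_def)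
    have G: "continuous_on nonneg_orthant (G i)" "\<And>Y. Y \<in> nonneg_orthant \<Longrightarrow> 0 \<le> G i Y"
      using assms(4)[OF i] by (auto simp: gev_cpgf_def cpgf_on_def)
    note cont = continuous_on_cpgf_exp_vec[OF G(1)]
    have "0 \<le> W i S"
    proof -
      obtain v where "W i S = G i (restrict_to S (exp_vec v))"
        using least_image_attained[OF V cont] unfolding W_def by blast
      then show ?thesis
        by (auto intro!: G(2) simp: nonneg_orthant_def restrict_to_def exp_vec_def)
    qed
    moreover have "W i S < W i (S \<union> {j})"
      unfolding W_def
    proof (rule least_image_strict_mono[OF V cont cont])
      show "G i (restrict_to S (exp_vec v)) < G i (restrict_to (S \<union> {j}) (exp_vec v))" for v
        using gev_cpgf_insert_less[OF assms(4)[OF i] \<open>j \<notin> S\<close>]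
        by (simp add: pos_orthant_def exp_vec_def)
    qed
    ultimately show ?thesis
      using assms(3)[OF i] by (intro divide_strict_left_mono) auto
  qed
  then have "(\<Sum>i\<in>I. q i / (1 + W i (S \<union> {j}))) < (\<Sum>i\<in>I. q i / (1 + W i S))"
    using assms(1,2) by (intro sum_strict_mono) auto
  then show ?thesis
    by (simp add: f_WC_def W_def)
qed

end
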